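(* For interval selection with unit weights, for every instance, every arrival order, every fixed optimal solution used as reference, and every assignment of binary predictions with total error $\eta$ (measured with respect to that optimal solution), Algorithm Naive outputs a set of pairwise disjoint intervals of total weight $ALG \geq OPT - \eta$.
   Context: Interval selection: an instance is a finite nonempty set $\mathcal{I}$ of intervals $[s_i,f_i)$ on the real line, $s_i<f_i$, arriving one at a time in an arbitrary (adversarial) order. Two intervals conflict if they intersect. Each interval $I$ has a weight $w(I)$; unit weights means $w(I)=1$ for all $I$. The goal is to output a set of pairwise disjoint intervals of maximum total weight. $OPT$ denotes the maximum total weight of a set of pairwise disjoint intervals of the instance, and $ALG$ the total weight of the algorithm's final solution. Predictions: each interval $I$ arrives together with a bit $Prd(I)\in\{0,1\}$; $Prd(I)=1$ means $I$ is predicted to belong to a fixed optimal solution $O$, and $Prd(I)=0$ means it is predicted not to belong to $O$. The prediction of $I$ is accurate if ($Prd(I)=1 \iff I\in O$). Predictions may be arbitrary. Error (with respect to $O$, which may be any optimal solution): $\eta(I)=0$ if the prediction of $I$ is accurate; $\eta(I)=w(I)$ if $I\in O$ and $Prd(I)=0$; $\eta(I)=\sum_{J\in\mathcal{C}}w(J)-w(I)$ if $I\notin O$ and $Prd(I)=1$, where $\mathcal{C}$ is the set of intervals of $O$ that conflict with $I$. The total error is $\eta=\sum_{I\in\mathcal{I}}\eta(I)$. Algorithm Naive: start with an empty solution; on the arrival of $I$, accept $I$ (irrevocably) if and only if $Prd(I)=1$ and $I$ conflicts with no interval currently in the solution. *)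

theory Defs
  imports Complex_Main
begin

text \<open>The pair \<open>(s, f)\<close> stands for the half-open interval \<open>[s, f)\<close>.  For \<open>s < f\<close> the pair is
  determined by the point set, so a set of such pairs is a set of intervals.\<close>

type_synonym ivl = "real \<times> real"

definition points :: "ivl \<Rightarrow> real set" where
  "points I = {fst I..<snd I}"

definition conflict :: "ivl \<Rightarrow> ivl \<Rightarrow> bool" where
  "conflict I J \<longleftrightarrow> points I \<inter> points J \<noteq> {}"

definition problem_instance :: "ivl set \<Rightarrow> bool" where
  "problem_instance \<I> \<longleftrightarrow> finite \<I> \<and> \<I> \<noteq> {} \<and> (\<forall>I\<in>\<I>. fst I < snd I)"

definition arrival_order :: "ivl set \<Rightarrow> ivl list \<Rightarrow> bool" where
  "arrival_order \<I> xs \<longleftrightarrow> distinct xs \<and> set xs = \<I>"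

definition feasible :: "ivl set \<Rightarrow> ivl set \<Rightarrow> bool" where
  "feasible \<I> S \<longleftrightarrow> S \<subseteq> \<I> \<and> pairwise (\<lambda>I J. \<not> conflict I J) S"

definition total_weight :: "(ivl \<Rightarrow> real) \<Rightarrow> ivl set \<Rightarrow> real" where
  "total_weight w S = (\<Sum>I\<in>S. w I)"

definition OPT :: "(ivl \<Rightarrow> real) \<Rightarrow> ivl set \<Rightarrow> real" where
  "OPT w \<I> = Max (total_weight w ` {S. feasible \<I> S})"

definition optimal_solution :: "(ivl \<Rightarrow> real) \<Rightarrow> ivl set \<Rightarrow> ivl set \<Rightarrow> bool" where
  "optimal_solution w \<I> S \<longleftrightarrow> feasible \<I> S \<and> total_weight w S = OPT w \<I>"

text \<open>Prediction bits are Booleans: \<open>Prd I\<close> means that \<open>I\<close> is predicted to belong to the reference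
  solution \<open>S\<close>.\<close>

definition ivl_error :: "(ivl \<Rightarrow> real) \<Rightarrow> ivl set \<Rightarrow> (ivl \<Rightarrow> bool) \<Rightarrow> ivl \<Rightarrow> real" where
  "ivl_error w S Prd I =
    (if Prd I \<longleftrightarrow> I \<in> S then 0
     else if I \<in> S then w I
     else (\<Sum>J\<in>{J\<in>S. conflict I J}. w J) - w I)"

definition total_error ::
    "(ivl \<Rightarrow> real) \<Rightarrow> ivl set \<Rightarrow> ivl set \<Rightarrow> (ivl \<Rightarrow> bool) \<Rightarrow> real" where
  "total_error w \<I> S Prd = (\<Sum>I\<in>\<I>. ivl_error w S Prd I)"

definition naive_step :: "(ivl \<Rightarrow> bool) \<Rightarrow> ivl set \<Rightarrow> ivl \<Rightarrow> ivl set" where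
  "naive_step Prd A I = (if Prd I \<and> (\<forall>J\<in>A. \<not> conflict I J) then insert I A else A)"

definition naive :: "(ivl \<Rightarrow> bool) \<Rightarrow> ivl list \<Rightarrow> ivl set" where
  "naive Prd xs = foldl (naive_step Prd) {} xs"

end

theory Submission
  imports Defs
begin

text \<open>Let \<open>P\<close> be the set of intervals predicted to be in \<open>S\<close>, let \<open>A\<close> be the output, and let
  \<open>c I\<close> be the number of intervals of \<open>S\<close> in conflict with \<open>I\<close>.  The output is a maximal
  independent subset of \<open>P\<close>, so each interval of \<open>(S \<inter> P) - A\<close> is blocked by one of \<open>A - S\<close>, and
  \<open>card (S \<inter> P) \<le> card A + (\<Sum>I\<in>A - S. c I - 1)\<close>.  Optimality of \<open>S\<close> gives \<open>c I \<ge> 1\<close> for every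
  \<open>I \<notin> S\<close>; hence the sum only grows when it is extended to \<open>P - S\<close>, where it is the error of the
  false positives.  The false negatives account for \<open>card (S - P)\<close>.\<close>

lemma conflict_sym: "conflict I J \<longleftrightarrow> conflict J I"
  by (auto simp: conflict_def)

lemma naive_snoc: "naive Prd (xs @ [x]) = naive_step Prd (naive Prd xs) x"
  by (simp add: naive_def)

lemma naive_subset: "naive Prd xs \<subseteq> {I \<in> set xs. Prd I}"
proof (induction xs rule: rev_induct)
  case Nil
  then show ?case by (simp add: naive_def)
next
  case (snoc x xs)
  then show ?case by (auto simp: naive_snoc naive_step_def)
qed

lemma naive_independent: "pairwise (\<lambda>I J. \<not> conflict I J) (naive Prd xs)"
proof (induction xs rule: rev_induct)
  case Nil
  then show ?case by (simp add: naive_def)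
next
  case (snoc x xs)
  then show ?case
    by (auto simp: naive_snoc naive_step_def pairwise_insert conflict_sym[of _ x])
qed

text \<open>A predicted interval is rejected only when something already accepted blocks it, and
  since nothing is ever discarded, the blocker is still in the final solution.\<close>

lemma naive_maximal:
  assumes "I \<in> set xs" "Prd I" "I \<notin> naive Prd xs"
  shows "\<exists>J\<in>naive Prd xs. conflict I J"
  using assms
proof (induction xs rule: rev_induct)
  case Nil
  then show ?case by simp
next
  case (snoc x xs)
  then show ?case by (auto simp: naive_snoc naive_step_def split: if_splits)
qed

lemma total_weight_unit:
  assumes "\<forall>I\<in>\<I>. w I = 1" "T \<subseteq> \<I>"
  shows "total_weight w T = card T"
proof -
  have "sum w T = (\<Sum>I\<in>T. 1)"
    using assms by (intro sum.cong) auto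
  then show ?thesis by (simp add: total_weight_def)
qed

lemma total_weight_le_OPT:
  assumes "finite \<I>" "feasible \<I> T"
  shows "total_weight w T \<le> OPT w \<I>"
proof -
  \<comment> \<open>\<open>OPT\<close> is a \<open>Max\<close>, which bounds its elements only for a
    finite set.\<close>
  have "finite {T. feasible \<I> T}"
    by (rule finite_subset[of _ "Pow \<I>"]) (use assms(1) in \<open>auto simp: feasible_def\<close>)
  then show ?thesis
    using assms(2) by (auto simp: OPT_def)
qed

text \<open>Otherwise adding \<open>I\<close> to \<open>S\<close> would stay feasible and raise the
  weight by one.\<close>

lemma optimal_solution_maximal:
  assumes fin: "finite \<I>" and unit: "\<forall>I\<in>\<I>. w I = 1"
    and opt: "optimal_solution w \<I> S" and I: "I \<in> \<I> - S"
  shows "\<exists>J\<in>S. conflict I J"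
proof (rule ccontr)
  assume free: "\<not> ?thesis"
  have S: "S \<subseteq> \<I>" "finite S"
    using opt fin by (auto simp: optimal_solution_def feasible_def dest: finite_subset)
  have "feasible \<I> (insert I S)"
    using opt I free
    by (auto simp: optimal_solution_def feasible_def pairwise_insert conflict_sym[of _ I])
  then have "total_weight w (insert I S) \<le> total_weight w S"
    using total_weight_le_OPT[OF fin] opt by (simp add: optimal_solution_def)
  moreover have "total_weight w (insert I S) = card (insert I S)" "total_weight w S = card S"
    using S I by (intro total_weight_unit[OF unit]; blast)+
  ultimately show False
    using S I by simp
qed

lemma total_error_unit:
  assumes fin: "finite \<I>" and unit: "\<forall>I\<in>\<I>. w I = 1" and S: "S \<subseteq> \<I>"
  shows "total_error w \<I> S Prd =
    card {I\<in>S. \<not> Prd I} + (\<Sum>I\<in>{I\<in>\<I>. Prd I} - S. real (card {J\<in>S. conflict I J}) - 1)"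
proof -
  let ?c = "\<lambda>I. real (card {J\<in>S. conflict I J}) - 1"
  \<comment> \<open>The two index sets, false negatives and false positives, are disjoint, so at
    most one summand is nonzero.\<close>
  have err: "ivl_error w S Prd I =
      (if I \<in> {I\<in>S. \<not> Prd I} then 1 else 0) + (if I \<in> {I\<in>\<I>. Prd I} - S then ?c I else 0)"
    if "I \<in> \<I>" for I
  proof -
    have "(\<Sum>J\<in>{J\<in>S. conflict I J}. w J) = card {J\<in>S. conflict I J}"
      using S total_weight_unit[OF unit, of "{J\<in>S. conflict I J}"]
      by (auto simp: total_weight_def)
    then show ?thesis
      using that unit by (simp add: ivl_error_def)
  qed
  \<comment> \<open>Read backwards, \<open>sum.inter_restrict\<close> turns an indicator sum over
    \<I> into a sum over an intersection. The deleted simp rules would unfold the membership tests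
    that it has to match.\<close>
  have "\<I> \<inter> {I\<in>S. \<not> Prd I} = {I\<in>S. \<not> Prd I}"
    "\<I> \<inter> ({I\<in>\<I>. Prd I} - S) = {I\<in>\<I>. Prd I} - S"
    using S by auto
  then show ?thesis
    by (simp add: total_error_def err sum.distrib sum.inter_restrict[OF fin, symmetric]
        del: mem_Collect_eq Diff_iff)
qed

theorem theorem3p1:
  fixes \<I> :: "ivl set" and w :: "ivl \<Rightarrow> real" and S :: "ivl set"
    and Prd :: "ivl \<Rightarrow> bool" and xs :: "ivl list"
  assumes "problem_instance \<I>"
    and "\<forall>I\<in>\<I>. w I = 1"
    and "arrival_order \<I> xs"
    and "optimal_solution w \<I> S"
  shows "feasible \<I> (naive Prd xs) \<and>
    total_weight w (naive Prd xs) \<ge> OPT w \<I> - total_error w \<I> S Prd"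
proof -
  define A where "A = naive Prd xs"
  define P where "P = {I\<in>\<I>. Prd I}"
  let ?C = "\<lambda>I. {J\<in>S. conflict I J}"
  have fin: "finite \<I>" and xs: "set xs = \<I>"
    using assms(1,3) by (auto simp: problem_instance_def arrival_order_def)
  have S: "S \<subseteq> \<I>" "pairwise (\<lambda>I J. \<not> conflict I J) S" and OPT: "OPT w \<I> = total_weight w S"
    using assms(4) by (auto simp: optimal_solution_def feasible_def)
  have A: "A \<subseteq> P"
    using naive_subset[of Prd xs] by (simp add: A_def P_def xs)
  have feas: "feasible \<I> A"
    using A naive_independent[of Prd xs] by (auto simp: feasible_def A_def P_def)
  have finP: "finite P" and finS: "finite S" and finA: "finite A"
    using fin S(1) A by (auto simp: P_def intro: finite_subset)
  have "S \<inter> P \<subseteq> (A \<inter> S) \<union> (\<Union>I\<in>A - S. ?C I)"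
  proof
    fix J assume J: "J \<in> S \<inter> P"
    show "J \<in> (A \<inter> S) \<union> (\<Union>I\<in>A - S. ?C I)"
    proof (cases "J \<in> A")
      case False
      then obtain I where I: "I \<in> A" "conflict J I"
        using J naive_maximal[of J xs Prd] by (auto simp: A_def P_def xs)
      \<comment> \<open>\<open>I\<close> differs from \<open>J\<close> because only \<open>I\<close>
        lies in \<open>A\<close>, and distinct members of \<open>S\<close> never conflict.\<close>
      then have "I \<notin> S"
        using J False S(2) by (auto simp: pairwise_def)
      then show ?thesis
        using I J conflict_sym[of I J] by auto
    qed (use J in auto)
  qed
  then have "card (S \<inter> P) \<le> card ((A \<inter> S) \<union> (\<Union>I\<in>A - S. ?C I))"
    using finA finS by (intro card_mono) auto
  also have "\<dots> \<le> card (A \<inter> S) + card (\<Union>I\<in>A - S. ?C I)"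
    by (rule card_Un_le)
  also have "card (\<Union>I\<in>A - S. ?C I) \<le> (\<Sum>I\<in>A - S. card (?C I))"
    using finA by (intro card_UN_le) auto
  finally have "real (card (S \<inter> P)) \<le> card (A \<inter> S) + (\<Sum>I\<in>A - S. real (card (?C I)))"
    by (simp flip: of_nat_sum of_nat_add)
  \<comment> \<open>Completing \<open>card (A \<inter> S)\<close> to \<open>card A\<close> costs one
    per element of \<open>A - S\<close>, which is the -1 in each term.\<close>
  also have "\<dots> = card A + (\<Sum>I\<in>A - S. real (card (?C I)) - 1)"
    using card_Int_Diff[OF finA, of S] by (simp add: sum_subtractf)
  also have "(\<Sum>I\<in>A - S. real (card (?C I)) - 1) \<le> (\<Sum>I\<in>P - S. real (card (?C I)) - 1)"
  proof (rule sum_mono2)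
    fix I assume "I \<in> (P - S) - (A - S)"
    then have "?C I \<noteq> {}"
      using optimal_solution_maximal[OF fin assms(2,4), of I] by (auto simp: P_def)
    then have "card (?C I) > 0"
      using finS by (simp add: card_gt_0_iff)
    then show "0 \<le> real (card (?C I)) - 1" by linarith
  qed (use A finP in auto)
  finally have "real (card (S \<inter> P)) \<le> card A + (\<Sum>I\<in>P - S. real (card (?C I)) - 1)"
    by simp
  moreover have "S - P = {I\<in>S. \<not> Prd I}"
    using S(1) by (auto simp: P_def)
  then have "total_error w \<I> S Prd = card (S - P) + (\<Sum>I\<in>P - S. real (card (?C I)) - 1)"
    using total_error_unit[OF fin assms(2) S(1), of Prd] by (simp add: P_def)
  \<comment> \<open>The false negatives \<open>card (S - P)\<close> also occur in the error, so they
    cancel in the final bound.\<close>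
  moreover have "OPT w \<I> = real (card (S \<inter> P)) + real (card (S - P))"
    using card_Int_Diff[OF finS, of P] total_weight_unit[OF assms(2) S(1)] OPT by simp
  moreover have "total_weight w A = card A"
    using A by (intro total_weight_unit[OF assms(2)]) (auto simp: P_def)
  ultimately show ?thesis
    using feas by (simp flip: A_def)
qed

end
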